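(* Let $s\ge 1$ be an integer and let $G$ be a finite simple graph with a proper vertex coloring. In each of the following cases, $G$ contains at least $s!/2$ distinct induced rainbow paths on $s$ vertices: (i) $G$ is $K_{2,r}$-free for some integer $r\ge 2$ and $\chi(G)\ge (r-1)(s-1)s/2+s$; (ii) $G$ has girth $g\ge 5$ and $\chi(G)\ge s^{1+\frac{4}{g-4}}$.
   Context: A graph is $H$-free if it contains no subgraph (not necessarily induced) isomorphic to $H$. A subgraph is rainbow (with respect to a proper vertex coloring) if no two of its vertices receive the same color; an induced rainbow path on $s$ vertices is an induced subgraph isomorphic to a path on $s$ vertices that is rainbow. The girth is the length of a shortest cycle; $\chi$ denotes chromatic number. *)

theory Defs
  imports "HOL-Library.Extended_Real"
begin

datatype 'a graph = Graph (verts: "'a set") (edges: "'a set set")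

definition simple_graph :: "'a graph \<Rightarrow> bool" where
  "simple_graph G \<longleftrightarrow> (\<forall>e\<in>edges G. e \<subseteq> verts G \<and> card e = 2)"

definition finite_simple_graph :: "'a graph \<Rightarrow> bool" where
  "finite_simple_graph G \<longleftrightarrow> simple_graph G \<and> finite (verts G)"

definition subgraph :: "'a graph \<Rightarrow> 'a graph \<Rightarrow> bool" where
  "subgraph H G \<longleftrightarrow> simple_graph H \<and> verts H \<subseteq> verts G \<and> edges H \<subseteq> edges G"

definition induced_subgraph :: "'a graph \<Rightarrow> 'a graph \<Rightarrow> bool" where
  "induced_subgraph H G \<longleftrightarrow> verts H \<subseteq> verts G \<and> edges H = {e \<in> edges G. e \<subseteq> verts H}"

definition isomorphic :: "'a graph \<Rightarrow> 'b graph \<Rightarrow> bool" where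
  "isomorphic G H \<longleftrightarrow>
     (\<exists>f. bij_betw f (verts G) (verts H) \<and> edges H = (\<lambda>e. f ` e) ` edges G)"

definition free_of :: "'b graph \<Rightarrow> 'a graph \<Rightarrow> bool" where
  "free_of H G \<longleftrightarrow> (\<nexists>K. subgraph K G \<and> isomorphic K H)"

definition complete_bipartite :: "nat \<Rightarrow> nat \<Rightarrow> (nat + nat) graph" where
  "complete_bipartite m n =
     Graph (Inl ` {..<m} \<union> Inr ` {..<n}) {{Inl i, Inr j} | i j. i < m \<and> j < n}"

definition path_graph :: "nat \<Rightarrow> nat graph" where
  "path_graph n = Graph {..<n} {{i, Suc i} | i. Suc i < n}"

text \<open>Only meaningful as a simple graph for \<open>n \<ge> 3\<close>.\<close>

definition cycle_graph :: "nat \<Rightarrow> nat graph" where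
  "cycle_graph n = Graph {..<n} {{i, Suc i mod n} | i. i < n}"

text \<open>The infimum of the empty set makes the girth of a forest \<open>\<infinity>\<close>.\<close>

definition girth :: "'a graph \<Rightarrow> enat" where
  "girth G = Inf {enat n | n. n \<ge> 3 \<and> (\<exists>K. subgraph K G \<and> isomorphic K (cycle_graph n))}"

definition proper_coloring :: "'a graph \<Rightarrow> ('a \<Rightarrow> 'c) \<Rightarrow> bool" where
  "proper_coloring G c \<longleftrightarrow> (\<forall>x y. {x, y} \<in> edges G \<longrightarrow> c x \<noteq> c y)"

text \<open>Intended for finite simple graphs, where a proper coloring with finitely many
  colors exists and \<open>LEAST\<close> is therefore attained.\<close>

definition chromatic_number :: "'a graph \<Rightarrow> nat" where
  "chromatic_number G =
     (LEAST k. \<exists>c :: 'a \<Rightarrow> nat. proper_coloring G c \<and> c ` verts G \<subseteq> {..<k})"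

definition rainbow :: "('a \<Rightarrow> 'c) \<Rightarrow> 'a graph \<Rightarrow> bool" where
  "rainbow c H \<longleftrightarrow> inj_on c (verts H)"

definition induced_rainbow_paths :: "'a graph \<Rightarrow> ('a \<Rightarrow> 'c) \<Rightarrow> nat \<Rightarrow> 'a graph set" where
  "induced_rainbow_paths G c s =
     {P. induced_subgraph P G \<and> isomorphic P (path_graph s) \<and> rainbow c P}"

text \<open>Extended arithmetic turns \<open>4 / (g - 4)\<close> into the usual real number for finite girth
  \<open>g \<ge> 5\<close>, and into \<open>0\<close> for girth \<open>\<infinity>\<close>.\<close>

lemma girth_exponent_finite:
  fixes g :: nat
  assumes "g \<ge> 5"
  shows "real_of_ereal (4 / (ereal_of_enat (enat g) - 4)) = 4 / (real g - 4)"
proof -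
  have "ereal_of_enat (enat g) - 4 = ereal (real g - 4)"
    by (metis ereal_minus(1) ereal_of_enat_simps(1) numeral_eq_ereal)
  moreover have "4 / ereal (real g - 4) = ereal (4 / (real g - 4))"
    using assms ereal_divide[of 4 "real g - 4"] by simp
  ultimately show ?thesis by simp
qed

lemma girth_exponent_infinite: "real_of_ereal (4 / (ereal_of_enat \<infinity> - 4)) = 0"
  by simp

end

theory Submission
  imports Defs "HOL-Combinatorics.Multiset_Permutations"
begin

text \<open>
  Fix a linear order of the colors and orient every edge towards its end of larger color. A rainbow
  sequence of \<open>s\<close> vertices is monotone for a fraction \<open>1 / s!\<close> of all orders, so if every order admits
  a monotone induced path on \<open>s\<close> vertices, there are at least \<open>s!\<close> such sequences, and each path is
  counted twice.

  For a given order, color the graph greedily along it; some vertex has color at least \<open>\<chi> - 1\<close>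
  (counting from \<open>0\<close>), and a vertex of color \<open>k\<close> has in-neighbors of all smaller colors. Descend from
  it, always stepping to an in-neighbor of the largest color among those that keep the path induced.
  The step from \<open>p\<^sub>j\<close> loses at most \<open>1 + d\<^sub>j\<close> colors, where \<open>d\<^sub>j\<close> counts the vertices off the path that
  are adjacent to \<open>p\<^sub>j\<close> and to an earlier vertex. In a \<open>K\<^sub>2\<^sub>,\<^sub>r\<close>-free graph \<open>d\<^sub>j \<le> (r - 1) j\<close>.

  For large girth, consider the hypergraph on the \<open>n\<close> path vertices whose hyperedges \<open>e\<close> are the path
  edges and the neighborhoods of the outside vertices. Then \<open>\<Sum> (1 + d\<^sub>j) \<le> 1 + \<Sum> (|e| - 1)\<close>, and there
  are no Berge cycles of length at most \<open>2k\<close> where \<open>k = (g - 1) div 4\<close>. Some ball satisfies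
  \<open>|B\<^sub>i\<^sub>+\<^sub>1| \<le> n\<^bsup>1/k\<^esup> |B\<^sub>i|\<close> with \<open>i < k\<close>; the hyperedges meeting \<open>B\<^sub>i\<close> form a hypertree inside
  \<open>B\<^sub>i\<^sub>+\<^sub>1\<close>, so cutting \<open>B\<^sub>i\<close> off costs at most \<open>|B\<^sub>i\<^sub>+\<^sub>1| - 1\<close>. Iterating bounds the sum by
  \<open>n\<^bsup>1 + 1/k\<^esup>\<close>, and \<open>1/k \<le> 4/(g - 4)\<close>.
\<close>

section \<open>Balls in graphs without short cycles\<close>

locale fin_graph =
  fixes V :: "'a set" and E :: "'a \<Rightarrow> 'a \<Rightarrow> bool"
  assumes finite_V: "finite V"
    and E_V: "E x y \<Longrightarrow> x \<in> V"
    and E_sym: "E x y \<Longrightarrow> E y x"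
    and E_irrefl: "\<not> E x x"
begin

definition no_short_cycle :: "nat \<Rightarrow> bool" where
  "no_short_cycle L \<longleftrightarrow> (\<forall>zs. distinct zs \<longrightarrow> 3 \<le> length zs \<longrightarrow> length zs \<le> L
     \<longrightarrow> successively E zs \<longrightarrow> \<not> E (last zs) (hd zs))"

text \<open>As long as a vertex repeats, the stretch between two of its occurrences can be cut out
  without changing the ends.\<close>

lemma walk_imp_path:
  assumes "ws \<noteq> []" "successively E ws"
  obtains us where "us \<noteq> []" "successively E us" "distinct us" "hd us = hd ws" "last us = last ws"
    "set us \<subseteq> set ws" "length us \<le> length ws"
proof -
  have "\<exists>us. us \<noteq> [] \<and> successively E us \<and> distinct us \<and> hd us = hd ws \<and> last us = last ws
    \<and> set us \<subseteq> set ws \<and> length us \<le> length ws"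
    using assms
  proof (induction "length ws" arbitrary: ws rule: less_induct)
    case less
    show ?case
    proof (cases "distinct ws")
      case False
      then obtain xs y ys zs where ws: "ws = xs @ [y] @ ys @ [y] @ zs"
        using not_distinct_decomp by blast
      let ?us = "xs @ [y] @ zs"
      have "successively E ?us"
        using less.prems(2) unfolding ws by (auto simp: successively_append_iff successively_Cons)
      moreover have "length ?us < length ws" "?us \<noteq> []" by (simp_all add: ws)
      moreover have "hd ?us = hd ws" "last ?us = last ws" "set ?us \<subseteq> set ws"
        by (auto simp: ws hd_append)
      ultimately show ?thesis using less.hyps[of ?us]
        by (metis (no_types, lifting) dual_order.trans less_imp_le)
    qed (use less.prems in auto)
  qed
  then show thesis using that by blast
qed

text \<open>Two neighbors of \<^term>\<open>q\<close> that are joined by a walk avoiding \<^term>\<open>q\<close> close up to a cycle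
  through \<^term>\<open>q\<close>.\<close>

lemma no_short_cycleD:
  assumes "no_short_cycle L" "successively E ws" "ws \<noteq> []" "q \<notin> set ws"
    and "E q (hd ws)" "E q (last ws)" "length ws < L"
  shows "hd ws = last ws"
proof (rule ccontr)
  assume ne: "hd ws \<noteq> last ws"
  obtain us where us: "us \<noteq> []" "successively E us" "distinct us" "hd us = hd ws" "last us = last ws"
    "set us \<subseteq> set ws" "length us \<le> length ws"
    using walk_imp_path assms by metis
  have "length us \<ge> 2"
  proof (rule ccontr)
    assume "\<not> length us \<ge> 2"
    then obtain u where "us = [u]" using us(1) by (cases us; cases "tl us") auto
    with us ne show False by auto
  qed
  moreover have "successively E (q # us)" "distinct (q # us)" "E (last (q # us)) (hd (q # us))"
    using us assms by (auto simp: successively_Cons E_sym)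
  ultimately show False
    using assms(1,7) us(7) unfolding no_short_cycle_def by (auto dest!: spec[of _ "q # us"])
qed

section \<open>Hypergraph balls and uplinks\<close>

text \<open>Distance is measured in the hypergraph on \<open>P\<close>: a vertex of \<open>X\<close>
  acts as the hyperedge of its neighbors, so one step uses either one edge of the graph or
  two.\<close>

fun ball :: "'a set \<Rightarrow> 'a set \<Rightarrow> 'a \<Rightarrow> nat \<Rightarrow> 'a set" where
  "ball P X v 0 = {v}"
| "ball P X v (Suc i) =
     ball P X v i \<union> {q \<in> P. \<exists>p\<in>ball P X v i. E p q \<or> (\<exists>x\<in>X. E p x \<and> E x q)}"

lemma ball_subset: "v \<in> P \<Longrightarrow> ball P X v i \<subseteq> P"
  by (induction i) auto

lemma ball_mono: "i \<le> j \<Longrightarrow> ball P X v i \<subseteq> ball P X v j"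
  by (induction j) (auto simp: le_Suc_eq)

definition depth :: "'a set \<Rightarrow> 'a set \<Rightarrow> 'a \<Rightarrow> 'a \<Rightarrow> nat" where
  "depth P X v q = (LEAST i. q \<in> ball P X v i)"

lemma depth_le: "q \<in> ball P X v i \<Longrightarrow> depth P X v q \<le> i"
  unfolding depth_def by (rule Least_le)

lemma in_ball_depth: "q \<in> ball P X v i \<Longrightarrow> q \<in> ball P X v (depth P X v q)"
  unfolding depth_def by (rule LeastI)

text \<open>Each level costs at most two further vertices. Control over the depths in the tail is
  what later keeps the walk away from a given vertex.\<close>

lemma walk_to_centre:
  assumes "q \<in> ball P X v i"
  shows "\<exists>ws. ws \<noteq> [] \<and> hd ws = q \<and> last ws = v \<and> successively E ws \<and> length ws \<le> 2 * i + 1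
    \<and> set (tl ws) \<subseteq> X \<union> {p. depth P X v p < depth P X v q}"
  using assms
proof (induction "depth P X v q" arbitrary: q i rule: less_induct)
  case less
  let ?d = "depth P X v"
  have q: "q \<in> ball P X v (?d q)" using less.prems by (rule in_ball_depth)
  show ?case
  proof (cases "?d q")
    case 0
    then show ?thesis using q by (intro exI[of _ "[v]"]) auto
  next
    case (Suc t)
    have "q \<notin> ball P X v t" using depth_le[of q P X v t] Suc by auto
    then obtain p where p: "p \<in> ball P X v t" "E p q \<or> (\<exists>x\<in>X. E p x \<and> E x q)"
      using q Suc by auto
    have dp: "?d p < ?d q" using depth_le[OF p(1)] Suc by simp
    obtain ws where ws: "ws \<noteq> []" "hd ws = p" "last ws = v" "successively E ws"
      "length ws \<le> 2 * t + 1" "set (tl ws) \<subseteq> X \<union> {r. ?d r < ?d p}"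
      using less.hyps[OF dp p(1)] by auto
    have sub: "set ws \<subseteq> X \<union> {r. ?d r < ?d q}"
      using ws(1,2,6) dp by (cases ws) auto
    have ti: "Suc t \<le> i" using depth_le[OF less.prems] Suc by simp
    show ?thesis
    proof (cases "E p q")
      case True
      then have "E q p" by (rule E_sym)
      then show ?thesis using ws sub ti
        by (intro exI[of _ "q # ws"]) (auto simp: successively_Cons)
    next
      case False
      then obtain x where "x \<in> X" "E p x" "E x q" using p by auto
      then have "E x p" "E q x" by (simp_all add: E_sym)
      then show ?thesis using ws sub ti \<open>x \<in> X\<close>
        by (intro exI[of _ "q # x # ws"]) (auto simp: successively_Cons)
    qed
  qed
qed

text \<open>The edges and hyperedges through which \<^term>\<open>q\<close> is linked to a vertex of the ball that is no
  deeper than \<^term>\<open>q\<close>. The girth leaves room for at most one, so charging every lost incidence to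
  such a \<^term>\<open>q\<close> is injective.\<close>

definition uplinks :: "'a set \<Rightarrow> 'a set \<Rightarrow> 'a \<Rightarrow> nat \<Rightarrow> 'a \<Rightarrow> 'a set" where
  "uplinks P X v i q =
    {a \<in> P. E a q \<and> a \<in> ball P X v i \<and> depth P X v a \<le> depth P X v q} \<union>
    {a \<in> X. E a q \<and> (\<exists>p\<in>ball P X v i. p \<noteq> q \<and> E a p \<and> depth P X v p \<le> depth P X v q)}"

text \<open>Start from a vertex of the ball that is different from \<open>q\<close> and no deeper.
  The rest of its walk to the centre lies in \<open>X\<close> or is strictly less deep, hence misses
  \<open>q\<close>. An uplink in \<open>X\<close> adds one vertex.\<close>

lemma uplink_walk:
  assumes "v \<in> P" "P \<inter> X = {}" "q \<in> P" "a \<in> uplinks P X v i q"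
  shows "\<exists>ws. ws \<noteq> [] \<and> hd ws = a \<and> last ws = v \<and> successively E ws \<and> length ws \<le> 2 * i + 2
    \<and> q \<notin> set ws"
proof -
  let ?d = "depth P X v"
  have *: "\<exists>ws. ws \<noteq> [] \<and> hd ws = p \<and> last ws = v \<and> successively E ws \<and> length ws \<le> 2 * i + 1
    \<and> q \<notin> set ws" if p: "p \<in> ball P X v i" "p \<noteq> q" "?d p \<le> ?d q" for p
  proof -
    obtain ws where ws: "ws \<noteq> []" "hd ws = p" "last ws = v" "successively E ws"
      "length ws \<le> 2 * i + 1" "set (tl ws) \<subseteq> X \<union> {r. ?d r < ?d p}"
      using walk_to_centre[OF p(1)] by auto
    have "q \<notin> set ws" using ws(1,2,6) p assms(2,3) by (cases ws) auto
    then show ?thesis using ws by blast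
  qed
  consider "a \<in> P" "E a q" "a \<in> ball P X v i" "?d a \<le> ?d q"
    | p where "a \<in> X" "E a q" "p \<in> ball P X v i" "p \<noteq> q" "E a p" "?d p \<le> ?d q"
    using assms(4) unfolding uplinks_def by blast
  then show ?thesis
  proof cases
    case 1
    then have "a \<noteq> q" using E_irrefl by auto
    then obtain ws where "ws \<noteq> []" "hd ws = a" "last ws = v" "successively E ws"
      "length ws \<le> 2 * i + 1" "q \<notin> set ws"
      using *[OF 1(3) _ 1(4)] by auto
    then show ?thesis by (intro exI[of _ ws]) auto
  next
    case 2
    obtain ws where ws: "ws \<noteq> []" "hd ws = p" "last ws = v" "successively E ws"
      "length ws \<le> 2 * i + 1" "q \<notin> set ws"
      using *[OF 2(3,4,6)] by auto
    have "a \<noteq> q" using 2(1) assms by auto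
    then show ?thesis using ws 2 by (intro exI[of _ "a # ws"]) (auto simp: successively_Cons)
  qed
qed

text \<open>The walks from two uplinks to \<open>v\<close> join to a walk of at most
  \<open>4 * i + 3\<close> vertices between neighbors of \<open>q\<close> that avoids
  \<open>q\<close>; the girth condition forces its ends to coincide.\<close>

lemma card_uplinks_le:
  assumes "no_short_cycle (4 * Suc i)" "v \<in> P" "P \<inter> X = {}" "q \<in> P"
  shows "card (uplinks P X v i q) \<le> 1"
proof -
  have "a = b" if a: "a \<in> uplinks P X v i q" and b: "b \<in> uplinks P X v i q" for a b
  proof -
    obtain as where as: "as \<noteq> []" "hd as = a" "last as = v" "successively E as"
      "length as \<le> 2 * i + 2" "q \<notin> set as"
      using uplink_walk[OF assms(2-4) a] by auto
    obtain bs where bs: "bs \<noteq> []" "hd bs = b" "last bs = v" "successively E bs"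
      "length bs \<le> 2 * i + 2" "q \<notin> set bs"
      using uplink_walk[OF assms(2-4) b] by auto
    \<comment> \<open>The second walk is reversed and its copy of \<open>v\<close> dropped, as
      \<open>v\<close> already ends \<open>as\<close>.\<close>
    obtain cs where cs: "rev bs = v # cs"
      using bs(1,3) by (metis hd_rev list.collapse rev_is_Nil_conv)
    have succ: "successively E (v # cs)"
      using bs(4) unfolding cs[symmetric]
      by (simp add: successively_rev) (metis E_sym successively_mono)
    let ?ws = "as @ cs"
    have "successively E ?ws"
      using as succ by (auto simp: successively_append_iff successively_Cons)
    moreover have "last ?ws = b"
      using bs(1,2) cs as(3) by (metis append_Nil2 last.simps last_append last_rev)
    moreover have "hd ?ws = a" using as by simp
    moreover have "q \<notin> set ?ws"
      using as bs cs by (metis Un_iff list.set_intros(2) set_append set_rev)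
    moreover have "length ?ws < 4 * Suc i"
      using as(5) bs(5) arg_cong[OF cs, of length] by simp
    moreover have "E q a" "E q b" using a b by (auto simp: uplinks_def E_sym)
    ultimately show ?thesis using no_short_cycleD[OF assms(1), of ?ws q] as(1) by auto
  qed
  then show ?thesis by (metis card_le_Suc0_iff_eq card.infinite One_nat_def le0)
qed

text \<open>Only \<open>v\<close> itself has depth 0. The centre therefore never receives a charge,
  which saves the 1 in \<open>excess_remove_ball\<close>.\<close>

lemma uplinks_centre:
  assumes "v \<in> P"
  shows "uplinks P X v i v = {}"
proof -
  have "depth P X v v = 0" using depth_le[of v P X v 0] by simp
  moreover have "p = v" if "p \<in> ball P X v i" "depth P X v p = 0" for p
    using in_ball_depth[OF that(1)] that(2) by simp
  ultimately show ?thesis using E_irrefl by (fastforce simp: uplinks_def)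
qed

text \<open>The number of edges inside \<^term>\<open>P\<close>, plus \<open>deg - 1\<close> for every outside vertex of \<^term>\<open>X\<close> seen as a
  hyperedge on \<^term>\<open>P\<close>; truncated subtraction makes vertices of \<^term>\<open>X\<close> without neighbors count \<open>0\<close>.\<close>

definition excess :: "'a set \<Rightarrow> 'a set \<Rightarrow> nat" where
  "excess P X = card {e. \<exists>p\<in>P. \<exists>q\<in>P. e = {p, q} \<and> E p q} + (\<Sum>x\<in>X. card {p \<in> P. E x p} - 1)"

text \<open>Everything lost with the ball is charged to pairs of a vertex \<open>q\<close> of the
  next larger ball and an uplink of \<open>q\<close>. Each \<open>q\<close> has at most one uplink
  and the centre has none.\<close>

lemma excess_remove_ball:
  assumes cyc: "no_short_cycle (4 * Suc i)" and v: "v \<in> P" and disj: "P \<inter> X = {}"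
    and fin: "finite P" "finite X"
  shows "excess P X \<le> excess (P - ball P X v i) X + (card (ball P X v (Suc i)) - 1)"
proof -
  let ?B = "ball P X v i" and ?Q = "ball P X v (Suc i) - {v}" and ?U = "uplinks P X v i"
  let ?d = "depth P X v"
  let ?ed = "\<lambda>P. {e. \<exists>p\<in>P. \<exists>q\<in>P. e = {p, q} \<and> E p q}"
  have BP: "ball P X v j \<subseteq> P" for j using ball_subset[OF v] .
  have finQ: "finite ?Q" using BP[of "Suc i"] fin by (meson finite_Diff finite_subset)
  have finU: "finite (?U q)" for q
    by (rule finite_subset[of _ "P \<union> X"]) (use fin in \<open>auto simp: uplinks_def\<close>)
  have Q: "q \<in> ?Q" if "q \<in> P" "q \<in> ball P X v (Suc i)" "?U q \<noteq> {}" for q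
    using uplinks_centre[OF v] that by auto

  \<comment> \<open>An edge is charged to its deeper end. If that is \<open>p\<close>, then
    \<open>q\<close> also lies in the ball and the roles are exchanged.\<close>
  have edge: "{p, q} \<in> (\<lambda>(q, a). {a, q}) ` (SIGMA q:?Q. ?U q \<inter> P)"
    if pq: "p \<in> ?B" "q \<in> P" "E p q" for p q
  proof -
    have p: "p \<in> P" using BP pq by auto
    have qS: "q \<in> ball P X v (Suc i)" using pq by auto
    show ?thesis
    proof (cases "?d p \<le> ?d q")
      case True
      then have "p \<in> ?U q \<inter> P" using pq p by (auto simp: uplinks_def)
      moreover then have "q \<in> ?Q" using Q pq qS by auto
      ultimately show ?thesis by (intro image_eqI[of _ _ "(q, p)"]) auto
    next
      case False
      then have "?d q \<le> i" using depth_le[OF pq(1)] by simp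
      then have "q \<in> ?B" using in_ball_depth[OF qS] ball_mono by blast
      then have "q \<in> ?U p \<inter> P" using pq False E_sym by (auto simp: uplinks_def)
      moreover then have "p \<in> ?Q" using Q[of p] pq p by auto
      ultimately show ?thesis by (intro image_eqI[of _ _ "(p, q)"]) auto
    qed
  qed
  have "?ed P \<subseteq> ?ed (P - ?B) \<union> (\<lambda>(q, a). {a, q}) ` (SIGMA q:?Q. ?U q \<inter> P)"
  proof
    fix e assume "e \<in> ?ed P"
    then obtain p q where e: "p \<in> P" "q \<in> P" "e = {p, q}" "E p q" by auto
    then show "e \<in> ?ed (P - ?B) \<union> (\<lambda>(q, a). {a, q}) ` (SIGMA q:?Q. ?U q \<inter> P)"
      using edge[of p q] edge[of q p] E_sym[OF e(4)]
      by (cases "p \<in> ?B"; cases "q \<in> ?B") (auto simp: insert_commute simp del: ball.simps)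
  qed
  then have "card (?ed P) \<le> card (?ed (P - ?B) \<union> (\<lambda>(q, a). {a, q}) ` (SIGMA q:?Q. ?U q \<inter> P))"
  proof (rule card_mono[rotated])
    have "?ed (P - ?B) \<subseteq> Pow P" by auto
    then show "finite (?ed (P - ?B) \<union> (\<lambda>(q, a). {a, q}) ` (SIGMA q:?Q. ?U q \<inter> P))"
      using fin finQ finU by (meson finite_Pow_iff finite_SigmaI finite_Int finite_UnI finite_imageI finite_subset)
  qed
  also have "\<dots> \<le> card (?ed (P - ?B)) + card (SIGMA q:?Q. ?U q \<inter> P)"
    by (rule order.trans[OF card_Un_le])
       (intro add_left_mono card_image_le finite_SigmaI finQ finite_Int disjI1 finU)
  finally have edges: "card (?ed P) \<le> card (?ed (P - ?B)) + card (SIGMA q:?Q. ?U q \<inter> P)" .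

  have hyper: "card {p \<in> P. E x p} - 1 \<le> (card {p \<in> P - ?B. E x p} - 1) + card {q \<in> ?Q. x \<in> ?U q}"
    if x: "x \<in> X" for x
  proof (cases "\<exists>p\<in>?B. E x p")
    case False
    then have "{p \<in> P. E x p} = {p \<in> P - ?B. E x p}" using BP by auto
    then show ?thesis by simp
  next
    case True
    \<comment> \<open>The neighbor \<open>p\<close> of \<open>x\<close> of least depth pays for the
      \<open>- 1\<close>; every other neighbor of \<open>x\<close> in \<open>P\<close> has
      \<open>x\<close> as an uplink.\<close>
    then obtain p where p: "p \<in> ?B" "E x p" and min: "\<And>r. r \<in> ?B \<Longrightarrow> E x r \<Longrightarrow> ?d p \<le> ?d r"
      using ex_has_least_nat[of "\<lambda>p. p \<in> ?B \<and> E x p" _ ?d] by blast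
    have "{q \<in> P. E x q} - {p} \<subseteq> {q \<in> ?Q. x \<in> ?U q}"
    proof
      fix q assume q: "q \<in> {q \<in> P. E x q} - {p}"
      have qS: "q \<in> ball P X v (Suc i)" using q p x E_sym by auto
      have "?d p \<le> ?d q"
      proof (cases "q \<in> ?B")
        case True then show ?thesis using min q by auto
      next
        case False
        then have "\<not> ?d q \<le> i" using in_ball_depth[OF qS] ball_mono by blast
        then show ?thesis using depth_le[OF p(1)] by simp
      qed
      then have "x \<in> ?U q" using x p q by (auto simp: uplinks_def)
      then show "q \<in> {q \<in> ?Q. x \<in> ?U q}" using Q[of q] qS q by blast
    qed
    then have "card ({q \<in> P. E x q} - {p}) \<le> card {q \<in> ?Q. x \<in> ?U q}"
      by (rule card_mono[rotated]) (use finQ in auto)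
    moreover have "card ({q \<in> P. E x q} - {p}) = card {q \<in> P. E x q} - 1"
      using p BP by (intro card_Diff_singleton) auto
    ultimately show ?thesis by simp
  qed
  have "(\<Sum>x\<in>X. card {p \<in> P. E x p} - 1)
    \<le> (\<Sum>x\<in>X. card {p \<in> P - ?B. E x p} - 1) + (\<Sum>x\<in>X. card {q \<in> ?Q. x \<in> ?U q})"
    unfolding sum.distrib[symmetric] by (intro sum_mono hyper)
  also have "(\<Sum>x\<in>X. card {q \<in> ?Q. x \<in> ?U q}) = (\<Sum>q\<in>?Q. card {x \<in> X. x \<in> ?U q})"
    by (rule sum_multicount_gen) (use finQ fin in auto)
  also have "\<dots> = card (SIGMA q:?Q. ?U q \<inter> X)"
    using finQ finU by (subst card_SigmaI) (auto intro!: sum.cong arg_cong[of _ _ card])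
  finally have hypers: "(\<Sum>x\<in>X. card {p \<in> P. E x p} - 1)
    \<le> (\<Sum>x\<in>X. card {p \<in> P - ?B. E x p} - 1) + card (SIGMA q:?Q. ?U q \<inter> X)" .

  have "card (SIGMA q:?Q. ?U q \<inter> P) + card (SIGMA q:?Q. ?U q \<inter> X) = (\<Sum>q\<in>?Q. card (?U q \<inter> P) + card (?U q \<inter> X))"
    using finQ finU by (subst (1 2) card_SigmaI) (auto simp: sum.distrib)
  also have "\<dots> \<le> (\<Sum>q\<in>?Q. 1)"
  proof (rule sum_mono)
    fix q assume "q \<in> ?Q"
    then have "q \<in> P" using BP[of "Suc i"] by blast
    have "card (?U q \<inter> P) + card (?U q \<inter> X) = card (?U q \<inter> P \<union> ?U q \<inter> X)"
      using finU disj by (subst card_Un_disjoint) auto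
    also have "\<dots> \<le> card (?U q)" by (intro card_mono finU) auto
    also have "\<dots> \<le> 1" using card_uplinks_le[OF cyc v disj \<open>q \<in> P\<close>] .
    finally show "card (?U q \<inter> P) + card (?U q \<inter> X) \<le> 1" .
  qed
  also have "\<dots> = card (ball P X v (Suc i)) - 1"
    using ball_mono[of 0 "Suc i" P X v] by (subst sum_constant, subst card_Diff_singleton) (simp_all del: ball.simps(2))
  finally show ?thesis using edges hypers unfolding excess_def by linarith
qed

text \<open>Cut off a ball that grows by a factor of at most \<open>b\<close> and apply induction to
  the rest. The number \<open>b\<close> stays fixed while \<open>P\<close> shrinks, so the
  hypothesis on \<open>card P\<close> is inherited.\<close>

lemma excess_bound:
  fixes b :: real
  assumes cyc: "no_short_cycle (4 * k)" and k: "k > 0" and b: "b \<ge> 1"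
    and "P \<noteq> {}" "finite P" "P \<inter> X = {}" "finite X" "real (card P) \<le> b ^ k"
  shows "real (excess P X) + 1 \<le> b * real (card P)"
  using assms(5,4,6-)
proof (induction P rule: finite_psubset_induct)
  case (psubset P)
  obtain v where v: "v \<in> P" using psubset.prems by auto
  let ?B = "ball P X v"
  have BP: "?B j \<subseteq> P" for j using ball_subset[OF v] .
  have finB: "finite (?B j)" for j using BP psubset.hyps finite_subset by blast
  \<comment> \<open>Growth by more than \<open>b\<close> in each of the \<open>k\<close> steps would
    give a ball with more than \<open>b ^ k\<close> vertices inside \<open>P\<close>.\<close>
  have "\<exists>i<k. real (card (?B (Suc i))) \<le> b * real (card (?B i))"
  proof (rule ccontr)
    assume "\<not> ?thesis"
    then have gr: "real (card (?B (Suc i))) > b * real (card (?B i))" if "i < k" for i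
      using that by (auto simp: not_le simp del: ball.simps)
    have "real (card (?B j)) \<ge> b ^ j" if "j \<le> k" for j
      using that
    proof (induction j)
      case (Suc j)
      have "b ^ Suc j \<le> b * real (card (?B j))" using Suc b by simp
      also have "\<dots> < real (card (?B (Suc j)))" using gr[of j] Suc.prems by simp
      finally show ?case by simp
    qed simp
    moreover obtain k' where k': "k = Suc k'" using k by (cases k) auto
    ultimately have "b ^ k \<le> b * real (card (?B k'))" using b by simp
    also have "\<dots> < real (card (?B k))" using gr[of k'] k' by simp
    also have "\<dots> \<le> real (card P)" using BP psubset.hyps by (simp add: card_mono)
    finally show False using psubset.prems by simp
  qed
  then obtain i where i: "i < k" "real (card (?B (Suc i))) \<le> b * real (card (?B i))" by blast
  have cyc': "no_short_cycle (4 * Suc i)" using cyc i(1) unfolding no_short_cycle_def by fastforce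
  have loss: "excess P X \<le> excess (P - ?B i) X + (card (?B (Suc i)) - 1)"
    using excess_remove_ball[OF cyc' v] psubset by blast
  have vB: "v \<in> ?B j" for j using ball_mono[of 0 j P X v] by auto
  have pos: "card (?B (Suc i)) > 0" using vB[of "Suc i"] finB[of "Suc i"] card_gt_0_iff by blast
  have cd: "card P = card (P - ?B i) + card (?B i)"
    using BP[of i] psubset.hyps finB by (metis add.commute card_mono card_Diff_subset le_add_diff_inverse)
  show ?case
  proof (cases "P - ?B i = {}")
    case True
    have "excess {} X = 0" by (simp add: excess_def)
    then have "real (excess P X) + 1 \<le> real (card (?B (Suc i)))"
      using loss pos unfolding True by linarith
    also have "\<dots> \<le> b * real (card P)" using i(2) cd True by simp
    finally show ?thesis .
  next
    case False
    have "P - ?B i \<subset> P" using vB v by auto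
    moreover have "real (card (P - ?B i)) \<le> b ^ k" using psubset.prems cd by simp
    ultimately have "real (excess (P - ?B i) X) + 1 \<le> b * real (card (P - ?B i))"
      using psubset.IH False psubset.prems by blast
    moreover have "real (excess P X) \<le> real (excess (P - ?B i) X) + real (card (?B (Suc i))) - 1"
      using loss pos by linarith
    ultimately show ?thesis using i(2) unfolding cd by (simp add: distrib_left)
  qed
qed

section \<open>Monotone induced paths\<close>

definition induced_path :: "'a list \<Rightarrow> bool" where
  "induced_path ps \<longleftrightarrow> distinct ps \<and> set ps \<subseteq> V \<and>
     (\<forall>i<length ps. \<forall>j<length ps. E (ps ! i) (ps ! j) \<longleftrightarrow> j = Suc i \<or> i = Suc j)"

lemma induced_path_Cons:
  "induced_path (p # ps) \<longleftrightarrow> p \<in> V \<and> p \<notin> set ps \<and> induced_path ps \<and>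
     (\<forall>i<length ps. E p (ps ! i) \<longleftrightarrow> i = 0)" (is "?L \<longleftrightarrow> ?R")
proof
  assume L: ?L
  then have adj: "E ((p # ps) ! i) ((p # ps) ! j) \<longleftrightarrow> j = Suc i \<or> i = Suc j"
    if "i < Suc (length ps)" "j < Suc (length ps)" for i j
    using that unfolding induced_path_def by simp
  have "E (ps ! i) (ps ! j) \<longleftrightarrow> j = Suc i \<or> i = Suc j" if "i < length ps" "j < length ps" for i j
    using adj[of "Suc i" "Suc j"] that by simp
  moreover have "E p (ps ! i) \<longleftrightarrow> i = 0" if "i < length ps" for i
    using adj[of 0 "Suc i"] that by simp
  ultimately show ?R using L unfolding induced_path_def by simp
next
  assume R: ?R
  have head: "E p (ps ! i) \<longleftrightarrow> i = 0" "E (ps ! i) p \<longleftrightarrow> i = 0" if "i < length ps" for i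
    using R that E_sym by blast+
  have tail: "E (ps ! i) (ps ! j) \<longleftrightarrow> j = Suc i \<or> i = Suc j" if "i < length ps" "j < length ps" for i j
    using R that unfolding induced_path_def by blast
  have "E ((p # ps) ! i) ((p # ps) ! j) \<longleftrightarrow> j = Suc i \<or> i = Suc j"
    if "i < Suc (length ps)" "j < Suc (length ps)" for i j
    using that E_irrefl[of p] head tail by (cases i; cases j) simp_all
  with R show ?L unfolding induced_path_def by simp
qed

lemma induced_path_Nil [simp]: "induced_path []"
  by (simp add: induced_path_def)

lemma induced_path_rev: "induced_path ps \<Longrightarrow> induced_path (rev ps)"
  unfolding induced_path_def by (auto simp: rev_nth)

lemma induced_path_hd:
  assumes "induced_path (p # ps)" "q \<in> set ps" "E p q"
  shows "q = hd ps"
  using assms by (auto simp: induced_path_Cons in_set_conv_nth hd_conv_nth)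

lemma induced_path_hd_adj: "induced_path (p # ps) \<Longrightarrow> ps \<noteq> [] \<Longrightarrow> E p (hd ps)"
  by (auto simp: induced_path_Cons hd_conv_nth)

lemma induced_path_ConsI:
  assumes "p \<in> V" "p \<notin> set ps" "induced_path ps" "E p (hd ps)" "\<And>q. q \<in> set (tl ps) \<Longrightarrow> \<not> E p q"
    and "ps \<noteq> []"
  shows "induced_path (p # ps)"
proof -
  have "E p (ps ! i) \<longleftrightarrow> i = 0" if "i < length ps" for i
    using that assms(4-6) by (cases ps; cases i) auto
  with assms show ?thesis by (simp add: induced_path_Cons)
qed

text \<open>The head has only one neighbor among the remaining vertices, so the next entry is forced
  at each step.\<close>

lemma induced_path_unique:
  assumes "induced_path ps" "induced_path qs" "set ps = set qs" "ps \<noteq> []" "hd ps = hd qs"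
  shows "ps = qs"
  using assms
proof (induction ps arbitrary: qs)
  case (Cons p ps)
  have "qs \<noteq> []" using Cons.prems by auto
  then obtain qs' where qs: "qs = p # qs'" using Cons.prems(5) by (cases qs) auto
  have sets: "set ps = set qs'"
    using Cons.prems(1-3) unfolding qs induced_path_Cons by auto
  show ?case
  proof (cases "ps = []")
    case False
    then have "qs' \<noteq> []" using sets by auto
    then have "hd ps = hd qs'"
      using induced_path_hd_adj[of p ps] induced_path_hd[of p qs' "hd ps"] Cons.prems(1,2) sets False
      unfolding qs by (metis hd_in_set)
    then show ?thesis
      using Cons.IH[of qs'] Cons.prems(1,2) sets False unfolding qs induced_path_Cons by auto
  qed (use sets qs in auto)
qed simp

lemma induced_path_eq_or_rev:
  assumes ps: "induced_path ps" and qs: "induced_path qs" and sets: "set ps = set qs"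
  shows "ps = qs \<or> ps = rev qs"
proof (cases "ps = []")
  case False
  then have ne: "qs \<noteq> []" using sets by auto
  then obtain q qs' where q: "qs = q # qs'" by (cases qs) auto
  have "q \<in> set ps" using sets q by simp
  then obtain i where i: "i < length ps" "ps ! i = q" by (auto simp: in_set_conv_nth)
  \<comment> \<open>An inner vertex of \<open>ps\<close> has two neighbors on the path, but
    \<open>q\<close> is an end of \<open>qs\<close> and has at most one.\<close>
  have "i = 0 \<or> Suc i = length ps"
  proof (rule ccontr)
    assume "\<not> ?thesis"
    then have i': "Suc i < length ps" "i > 0" "i - 1 < length ps" using i(1) by auto
    have "E q (ps ! Suc i)" "E q (ps ! (i - 1))"
      using ps i i' unfolding induced_path_def by auto
    moreover have "ps ! Suc i \<in> set qs'" "ps ! (i - 1) \<in> set qs'"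
      using calculation i' sets E_irrefl q nth_mem by (metis set_ConsD)+
    ultimately have "ps ! Suc i = ps ! (i - 1)"
      using induced_path_hd[of q qs'] qs unfolding q by metis
    moreover have "distinct ps" using ps unfolding induced_path_def by simp
    ultimately show False using i' by (simp add: nth_eq_iff_index_eq)
  qed
  then show ?thesis
  proof
    assume "i = 0"
    then have "hd ps = hd qs" using i q False by (simp add: hd_conv_nth)
    then show ?thesis using induced_path_unique[OF ps qs sets False] by simp
  next
    assume "Suc i = length ps"
    then have "last ps = q" using i(2) False by (metis last_conv_nth diff_Suc_1)
    then have "hd (rev ps) = hd qs" using q by (simp add: hd_rev)
    then have "rev ps = qs"
      using induced_path_unique[OF induced_path_rev[OF ps] qs] sets False by simp
    then show ?thesis by auto
  qed
qed (use sets in auto)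

section \<open>Greedy coloring and the descent along it\<close>

text \<open>Recursion along \<open>h\<close>: a vertex receives the least color missing among its
  neighbors of smaller \<open>h\<close>, which exists because \<open>V\<close> is finite.\<close>

lemma first_fit_coloring:
  fixes h :: "'a \<Rightarrow> nat"
  obtains \<phi> :: "'a \<Rightarrow> nat"
  where "\<And>v k. k < \<phi> v \<Longrightarrow> \<exists>u. E u v \<and> h u < h v \<and> \<phi> u = k"
    and "\<And>u v. E u v \<Longrightarrow> h u < h v \<Longrightarrow> \<phi> u \<noteq> \<phi> v"
proof -
  define Q where "Q f v r \<longleftrightarrow> (\<forall>k<r. \<exists>u. E u v \<and> h u < h v \<and> f u = k) \<and>
    (\<forall>u. E u v \<longrightarrow> h u < h v \<longrightarrow> f u \<noteq> r)" for f :: "'a \<Rightarrow> nat" and v r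
  have "\<exists>f. \<forall>v. Q f v (f v)"
  proof (rule dependent_wf_choice)
    show "wf (measure h)" by simp
    show "Q f v r = Q g v r" if "\<And>u. (u, v) \<in> measure h \<Longrightarrow> f u = g u" for f g v r
      using that unfolding Q_def by (metis in_measure)
    show "\<exists>r. Q f v r" for v f
    proof -
      have "finite (f ` {u \<in> V. E u v \<and> h u < h v})" using finite_V by simp
      then have "\<exists>r. r \<notin> f ` {u \<in> V. E u v \<and> h u < h v}" by (rule ex_new_if_finite[OF infinite_UNIV_nat])
      then obtain r0 where "r0 \<notin> f ` {u \<in> V. E u v \<and> h u < h v}" ..
      then have r0: "\<forall>u. E u v \<longrightarrow> h u < h v \<longrightarrow> f u \<noteq> r0" using E_V by auto
      define r where "r = (LEAST r. \<forall>u. E u v \<longrightarrow> h u < h v \<longrightarrow> f u \<noteq> r)"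
      have "\<forall>u. E u v \<longrightarrow> h u < h v \<longrightarrow> f u \<noteq> r" unfolding r_def using r0 by (rule LeastI)
      moreover have "\<exists>u. E u v \<and> h u < h v \<and> f u = k" if "k < r" for k
        using not_less_Least[OF that[unfolded r_def]] by auto
      ultimately show ?thesis unfolding Q_def by blast
    qed
  qed
  then show thesis using that unfolding Q_def by blast
qed

text \<open>The outside neighbors of the head that would create a chord when prepended. Path
  vertices are left out because monotonicity already excludes them.\<close>

definition blocked :: "'a list \<Rightarrow> 'a set" where
  "blocked ps = {x \<in> V. x \<notin> set ps \<and> E x (hd ps) \<and> (\<exists>y\<in>set (tl ps). E x y)}"

text \<open>Bounds the colors lost while the path grows through all its suffixes and once beyond:
  each extension loses one color, plus at most one per blocked vertex.\<close>

fun cost :: "'a list \<Rightarrow> nat" where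
  "cost [] = 0"
| "cost (p # ps) = 1 + card (blocked (p # ps)) + cost ps"

lemma finite_blocked [simp]: "finite (blocked ps)"
  unfolding blocked_def using finite_V by simp

text \<open>The path is built from its end backwards: \<^term>\<open>hd ps\<close> has in-neighbors of all colors below
  \<^term>\<open>\<phi> (hd ps)\<close>, and we continue with one of the largest possible color outside
  \<^term>\<open>blocked ps\<close>.\<close>

lemma monotone_induced_path:
  fixes h \<phi> :: "'a \<Rightarrow> nat"
  assumes \<phi>: "\<And>v k. k < \<phi> v \<Longrightarrow> \<exists>u. E u v \<and> h u < h v \<and> \<phi> u = k"
    and v: "v \<in> V" "K \<le> \<phi> v"
    and cost: "\<And>ps. induced_path ps \<Longrightarrow> ps \<noteq> [] \<Longrightarrow> length ps < s \<Longrightarrow> cost ps \<le> K"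
    and "1 \<le> n" "n \<le> s"
  shows "\<exists>ps. induced_path ps \<and> length ps = n \<and> sorted_wrt (\<lambda>x y. h x < h y) ps
    \<and> K \<le> \<phi> (hd ps) + cost (tl ps)"
  using assms(5,6)
proof (induction n rule: nat_induct_at_least)
  case base
  have "induced_path [v]" using v by (simp add: induced_path_Cons)
  then show ?case using v by (intro exI[of _ "[v]"]) simp
next
  case (Suc n)
  then obtain ps where ps: "induced_path ps" "length ps = n" "sorted_wrt (\<lambda>x y. h x < h y) ps"
    "K \<le> \<phi> (hd ps) + cost (tl ps)" by auto
  then have ne: "ps \<noteq> []" using Suc.hyps by auto
  then obtain p qs where pqs: "ps = p # qs" by (cases ps) auto
  let ?b = "card (blocked ps)"
  have "cost ps \<le> K" using cost[OF ps(1) ne] ps(2) Suc.prems by simp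
  \<comment> \<open>The cost bound ensures that enough colors remain below \<open>\<phi> p\<close>,
    so the truncated subtractions in \<open>?C\<close> are exact.\<close>
  then have b: "?b < \<phi> p" using ps(4) unfolding pqs by simp
  \<comment> \<open>The \<open>?b + 1\<close> largest colors below \<open>\<phi> p\<close>. The
    blocked vertices show at most \<open>?b\<close> of them, so an in-neighbor of some color in
    \<open>?C\<close> is free.\<close>
  let ?C = "{\<phi> p - 1 - ?b..\<phi> p - 1}"
  have "card ?C = Suc ?b" using b by simp
  moreover have "card (\<phi> ` blocked ps) \<le> ?b" by (rule card_image_le) simp
  ultimately have "\<not> ?C \<subseteq> \<phi> ` blocked ps"
    using card_mono[of "\<phi> ` blocked ps" ?C] by fastforce
  then obtain k where k: "k \<in> ?C" "k \<notin> \<phi> ` blocked ps" by blast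
  then have "k < \<phi> p" using b by auto
  then obtain u where u: "E u p" "h u < h p" "\<phi> u = k" using \<phi> by blast
  have less: "h u < h y" if "y \<in> set ps" for y
    using that ps(3) u(2) unfolding pqs by auto
  then have un: "u \<notin> set ps" by blast
  have "u \<notin> blocked ps" using k u by auto
  then have "\<not> E u q" if "q \<in> set (tl ps)" for q
    using that u un E_V unfolding blocked_def pqs by auto
  then have "induced_path (u # ps)"
    using u un E_V ne ps(1) by (intro induced_path_ConsI) (auto simp: pqs)
  moreover have "K \<le> \<phi> u + cost ps" using ps(4) k(1) b u(3) unfolding pqs by auto
  ultimately show ?case
    using ps less by (intro exI[of _ "u # ps"]) auto
qed

section \<open>Bounds on the cost\<close>

text \<open>A blocked vertex is a common neighbor of the head and a later vertex, so
  \<open>m\<close> later vertices give at most \<open>d * m\<close> of them. Summed up, the cost is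
  at most \<open>l + d * l * (l - 1) / 2\<close> for length \<open>l\<close>; the form chosen avoids
  division and subtraction.\<close>

lemma cost_bound_codegree:
  assumes deg: "\<And>x y. x \<noteq> y \<Longrightarrow> card {z. E z x \<and> E z y} \<le> d"
    and "induced_path ps"
  shows "2 * cost ps + d * length ps \<le> 2 * length ps + d * (length ps)\<^sup>2"
  using assms(2)
proof (induction ps)
  case (Cons p ps)
  have "blocked (p # ps) \<subseteq> (\<Union>y\<in>set ps. {z. E z p \<and> E z y})" unfolding blocked_def by auto
  moreover have fin: "finite {z. E z p \<and> E z y}" for y
    by (rule finite_subset[OF _ finite_V]) (use E_V in blast)
  ultimately have "card (blocked (p # ps)) \<le> card (\<Union>y\<in>set ps. {z. E z p \<and> E z y})"
    by (intro card_mono) auto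
  also have "\<dots> \<le> (\<Sum>y\<in>set ps. card {z. E z p \<and> E z y})" by (rule card_UN_le) simp
  also have "\<dots> \<le> (\<Sum>y\<in>set ps. d)"
    using Cons.prems by (intro sum_mono deg) (auto simp: induced_path_Cons)
  also have "\<dots> = d * length ps"
    using Cons.prems by (simp add: induced_path_def distinct_card)
  finally have "card (blocked (p # ps)) \<le> d * length ps" .
  moreover have "induced_path ps" using Cons.prems by (simp add: induced_path_Cons)
  ultimately show ?case using Cons.IH by (simp add: power2_eq_square algebra_simps)
qed simp

text \<open>Mirrors one step of \<open>cost\<close>: the path edge gives 1, and each vertex of
  \<open>D\<close> gains an incidence. As it already has a neighbor in \<open>P\<close>, the
  truncated \<open>- 1\<close> does not swallow this gain.\<close>

lemma excess_insert:
  assumes "finite X" "finite P" "p \<notin> P" "D \<subseteq> X" "p' \<in> P" "E p p'"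
    and D: "\<And>x. x \<in> D \<Longrightarrow> E x p \<and> (\<exists>y\<in>P. E x y)"
  shows "excess P X + 1 + card D \<le> excess (insert p P) X"
proof -
  let ?ed = "\<lambda>P. {e. \<exists>p\<in>P. \<exists>q\<in>P. e = {p, q} \<and> E p q}"
  have "?ed (insert p P) \<subseteq> Pow (insert p P)" by auto
  then have fin: "finite (?ed (insert p P))" using assms by (meson finite.insertI finite_Pow_iff finite_subset)
  have sub: "insert {p, p'} (?ed P) \<subseteq> ?ed (insert p P)" using assms by blast
  have "{p, p'} \<notin> ?ed P" using assms(3) by (auto simp: doubleton_eq_iff)
  moreover have "finite (?ed P)" using finite_subset[OF sub fin] by (simp only: finite_insert)
  ultimately have edges: "card (?ed P) + 1 \<le> card (?ed (insert p P))"
    using card_mono[OF fin sub] by simp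
  have "card {q \<in> P. E x q} - 1 + (if x \<in> D then 1 else 0) \<le> card {q \<in> insert p P. E x q} - 1" for x
  proof (cases "x \<in> D")
    case True
    then obtain y where y: "y \<in> P" "E x y" "E x p" using D by blast
    have "{q \<in> insert p P. E x q} = insert p {q \<in> P. E x q}" using y by auto
    then have "card {q \<in> insert p P. E x q} = Suc (card {q \<in> P. E x q})"
      using assms by simp
    moreover have "card {q \<in> P. E x q} > 0" using y assms(2) by (auto simp: card_gt_0_iff)
    ultimately show ?thesis using True by simp
  next
    case False
    have "card {q \<in> P. E x q} \<le> card {q \<in> insert p P. E x q}" using assms by (intro card_mono) auto
    then show ?thesis using False by simp
  qed
  then have "(\<Sum>x\<in>X. card {q \<in> P. E x q} - 1 + (if x \<in> D then 1 else 0))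
    \<le> (\<Sum>x\<in>X. card {q \<in> insert p P. E x q} - 1)" by (intro sum_mono)
  moreover have "(\<Sum>x\<in>X. if x \<in> D then 1 else 0) = card D"
    using assms by (simp add: sum.If_cases Int_absorb1)
  ultimately show ?thesis using edges unfolding excess_def by (simp add: sum.distrib)
qed

text \<open>The prefix \<open>qs\<close> keeps the outside set unchanged while the induction passes
  to suffixes. The final 1 is the cost of a single vertex.\<close>

lemma cost_le_excess:
  assumes "induced_path (qs @ ps)" "ps \<noteq> []"
  shows "cost ps \<le> excess (set ps) (V - set (qs @ ps)) + 1"
  using assms
proof (induction ps arbitrary: qs)
  case (Cons p ps)
  have suffix: "induced_path (qs @ ps) \<Longrightarrow> induced_path ps" for qs ps
    by (induction qs) (auto simp: induced_path_Cons)
  show ?case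
  proof (cases "ps = []")
    case True
    then show ?thesis by (simp add: blocked_def)
  next
    case False
    have IH: "cost ps \<le> excess (set ps) (V - set (qs @ p # ps)) + 1"
      using Cons.IH[of "qs @ [p]"] Cons.prems False by simp
    have pps: "induced_path (p # ps)" using suffix Cons.prems by blast
    \<comment> \<open>On an induced path \<open>x\<close> is adjacent to only one later vertex,
      whereas a blocked vertex would need both \<open>p\<close> and some \<open>y\<close> in
      \<open>ps\<close>.\<close>
    have "x \<notin> blocked (p # ps)" if x: "x \<in> set qs" for x
    proof
      assume b: "x \<in> blocked (p # ps)"
      obtain qs1 qs2 where qs: "qs = qs1 @ x # qs2" using x by (meson split_list)
      have ip: "induced_path (x # qs2 @ p # ps)" using Cons.prems(1) suffix[of qs1] unfolding qs by simp
      obtain y where y: "E x p" "y \<in> set ps" "E x y" using b by (auto simp: blocked_def)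
      have "p = y" using induced_path_hd[OF ip, of p] induced_path_hd[OF ip, of y] y by auto
      then show False using y(2) pps by (simp add: induced_path_Cons)
    qed
    then have D: "blocked (p # ps) \<subseteq> V - set (qs @ p # ps)" unfolding blocked_def by auto
    have "excess (set ps) (V - set (qs @ p # ps)) + 1 + card (blocked (p # ps))
      \<le> excess (insert p (set ps)) (V - set (qs @ p # ps))"
      by (rule excess_insert[of _ _ _ _ "hd ps"])
         (use finite_V D False pps induced_path_hd_adj[OF pps] in
           \<open>auto simp: induced_path_Cons blocked_def\<close>)
    then show ?thesis using IH by simp
  qed
qed simp

lemma cost_bound_girth:
  fixes b :: real
  assumes "no_short_cycle (4 * k)" "k > 0" "b \<ge> 1" "induced_path ps" "real (length ps) \<le> b ^ k"
  shows "real (cost ps) \<le> b * real (length ps)"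
proof (cases "ps = []")
  case False
  have len: "card (set ps) = length ps"
    using assms(4) by (simp add: induced_path_def distinct_card)
  have "real (cost ps) \<le> real (excess (set ps) (V - set ps)) + 1"
    using cost_le_excess[of "[]" ps] assms(4) False by simp
  also have "\<dots> \<le> b * real (card (set ps))"
    by (rule excess_bound[OF assms(1-3)]) (use False finite_V assms(5) len in auto)
  finally show ?thesis using len by simp
qed simp

end

section \<open>Double counting over color orders\<close>

text \<open>A permutation of \<open>C\<close> that lists \<open>S\<close> in the order
  \<open>ys\<close> is a shuffle of \<open>ys\<close> with a permutation of \<open>C - S\<close>.
  Hence at most a fraction \<open>1 / fact (card S)\<close> of all permutations does so.\<close>

lemma card_permutations_restrict_le:
  assumes "finite C" "ys \<in> permutations_of_set S" "S \<subseteq> C"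
  shows "card {xs \<in> permutations_of_set C. filter (\<lambda>x. x \<in> S) xs = ys} * fact (card S) \<le> fact (card C)"
proof -
  have S: "finite S" "card S \<le> card C" "length ys = card S"
    using finite_subset[OF assms(3,1)] card_mono[OF assms(1,3)] length_finite_permutations_of_set[OF assms(2)]
    by simp_all
  have "{xs \<in> permutations_of_set C. filter (\<lambda>x. x \<in> S) xs = ys}
    \<subseteq> (\<Union>zs\<in>permutations_of_set (C - S). shuffles ys zs)"
  proof
    fix xs assume xs: "xs \<in> {xs \<in> permutations_of_set C. filter (\<lambda>x. x \<in> S) xs = ys}"
    then have "xs \<in> shuffles ys (filter (\<lambda>x. x \<notin> S) xs)"
      using partition_in_shuffles[of xs "\<lambda>x. x \<in> S"] by (simp add: o_def)
    moreover have "filter (\<lambda>x. x \<notin> S) xs \<in> permutations_of_set (C - S)"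
      using xs by (auto simp: permutations_of_set_def)
    ultimately show "xs \<in> (\<Union>zs\<in>permutations_of_set (C - S). shuffles ys zs)" by blast
  qed
  then have "card {xs \<in> permutations_of_set C. filter (\<lambda>x. x \<in> S) xs = ys}
    \<le> card (\<Union>zs\<in>permutations_of_set (C - S). shuffles ys zs)"
    by (intro card_mono) auto
  also have "\<dots> \<le> (\<Sum>zs\<in>permutations_of_set (C - S). card (shuffles ys zs))"
    by (rule card_UN_le) simp
  also have "\<dots> = (\<Sum>zs\<in>permutations_of_set (C - S). card C choose card S)"
  proof (rule sum.cong)
    fix zs assume zs: "zs \<in> permutations_of_set (C - S)"
    then have "length zs = card C - card S"
      using assms S by (simp add: length_finite_permutations_of_set card_Diff_subset)
    moreover have "set ys \<inter> set zs = {}"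
      using zs assms(2) by (auto simp: permutations_of_set_def)
    ultimately show "card (shuffles ys zs) = card C choose card S"
      using S card_disjoint_shuffles[of ys zs] by simp
  qed simp
  also have "\<dots> = fact (card C - card S) * (card C choose card S)"
    using assms S by (simp add: card_Diff_subset)
  finally have "card {xs \<in> permutations_of_set C. filter (\<lambda>x. x \<in> S) xs = ys} * fact (card S)
    \<le> fact (card C - card S) * (card C choose card S) * fact (card S)" by (rule mult_le_mono1)
  also have "\<dots> = fact (card C)"
    using binomial_fact_lemma[OF S(2)] by (simp add: ac_simps)
  finally show ?thesis .
qed

text \<open>Every order of the colors yields a path whose colors appear in that order, and each
  rainbow list serves at most a fraction \<open>1 / fact s\<close> of the orders.\<close>

lemma (in fin_graph) fact_le_card_rainbow_paths:
  fixes c :: "'a \<Rightarrow> 'c"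
  assumes col: "\<And>x y. E x y \<Longrightarrow> c x \<noteq> c y"
    and ex: "\<And>h :: 'a \<Rightarrow> nat. (\<And>x y. E x y \<Longrightarrow> h x \<noteq> h y) \<Longrightarrow>
      \<exists>ps. induced_path ps \<and> length ps = s \<and> sorted_wrt (\<lambda>x y. h x < h y) ps"
  shows "fact s \<le> card {ps. induced_path ps \<and> length ps = s \<and> distinct (map c ps)}"
proof -
  define R where "R = {ps. induced_path ps \<and> length ps = s \<and> distinct (map c ps)}"
  define C where "C = c ` V"
  define F where "F ps = {xs \<in> permutations_of_set C. filter (\<lambda>x. x \<in> set (map c ps)) xs = map c ps}" for ps
  have finC: "finite C" unfolding C_def using finite_V by simp
  have "R \<subseteq> {ps. set ps \<subseteq> V \<and> length ps = s}" unfolding R_def induced_path_def by auto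
  then have finR: "finite R" using finite_lists_length_eq[OF finite_V] finite_subset by blast
  have "permutations_of_set C \<subseteq> (\<Union>ps\<in>R. F ps)"
  proof
    fix xs assume xs: "xs \<in> permutations_of_set C"
    then have xs': "set xs = C" "distinct xs" by (auto simp: permutations_of_set_def)
    \<comment> \<open>The position of a color in the order \<open>xs\<close>; composed with
      \<open>c\<close> it gives the function \<open>h\<close> to which \<open>ex\<close> is
      applied.\<close>
    define idx where "idx = inv_into {..<length xs} ((!) xs)"
    have idx: "idx (xs ! i) = i" if "i < length xs" for i
      unfolding idx_def using that xs' by (intro inv_into_f_f inj_on_nth) auto
    have sorted: "sorted_wrt (\<lambda>a b. idx a < idx b) xs"
      by (simp add: sorted_wrt_iff_nth_less idx)
    have inj: "inj_on idx C"
      unfolding xs'(1)[symmetric] by (rule inj_onI) (metis in_set_conv_nth idx)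
    have h: "idx (c x) \<noteq> idx (c y)" if "E x y" for x y
      using inj_onD[OF inj, of "c x" "c y"] col[OF that] that E_V E_sym unfolding C_def by blast
    obtain ps where ps: "induced_path ps" "length ps = s" "sorted_wrt (\<lambda>x y. idx (c x) < idx (c y)) ps"
      using ex[of "\<lambda>x. idx (c x)"] h by blast
    let ?ys = "map c ps" and ?zs = "filter (\<lambda>x. x \<in> set (map c ps)) xs"
    have sub: "set ?ys \<subseteq> C" using ps(1) unfolding induced_path_def C_def by auto
    have sets: "set ?zs = set ?ys" using sub xs' by auto
    \<comment> \<open>Strictly increasing lists of positions with equal sets coincide. So
      \<open>map c ps\<close> is a sublist of \<open>xs\<close>, which also makes \<open>ps\<close>
      rainbow.\<close>
    have "sorted_wrt (<) (map idx ?ys)" using ps(3) by (simp add: sorted_wrt_map)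
    moreover have "sorted_wrt (<) (map idx ?zs)"
      using sorted_wrt_filter[OF sorted] by (simp only: sorted_wrt_map)
    moreover have "set (map idx ?ys) = set (map idx ?zs)" by (simp only: set_map[of idx] sets)
    ultimately have "map idx ?ys = map idx ?zs" by (intro strict_sorted_equal) simp_all
    from this[symmetric] have "?zs = ?ys"
      by (rule map_inj_on) (use inj_on_subset[OF inj sub] sets in simp)
    moreover have "distinct ?zs" using xs' by simp
    ultimately have "ps \<in> R" "xs \<in> F ps" using ps xs unfolding R_def F_def by auto
    then show "xs \<in> (\<Union>ps\<in>R. F ps)" by blast
  qed
  then have "card (permutations_of_set C) \<le> card (\<Union>ps\<in>R. F ps)"
    by (intro card_mono) (auto simp: finR F_def)
  also have "\<dots> \<le> (\<Sum>ps\<in>R. card (F ps))" using finR by (rule card_UN_le)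
  finally have "fact (card C) * fact s \<le> (\<Sum>ps\<in>R. card (F ps)) * fact s"
    using finC by simp
  also have "\<dots> = (\<Sum>ps\<in>R. card (F ps) * fact s)" by (rule sum_distrib_right)
  also have "\<dots> \<le> (\<Sum>ps\<in>R. fact (card C))"
  proof (rule sum_mono)
    fix ps assume ps: "ps \<in> R"
    then have "card (set (map c ps)) = s" "map c ps \<in> permutations_of_set (set (map c ps))"
      "set (map c ps) \<subseteq> C"
      unfolding R_def C_def by (auto simp: distinct_card[of "map c ps", simplified] induced_path_def)
    then show "card (F ps) * fact s \<le> fact (card C)"
      using card_permutations_restrict_le[OF finC] unfolding F_def by metis
  qed
  also have "\<dots> = fact (card C) * card R" by simp
  finally show ?thesis unfolding R_def by simp
qed

section \<open>Transfer between \<open>graph\<close> and \<open>fin_graph\<close>\<close>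

definition adj :: "'a graph \<Rightarrow> 'a \<Rightarrow> 'a \<Rightarrow> bool" where
  "adj G x y \<longleftrightarrow> {x, y} \<in> edges G"

lemma fin_graph_adj:
  assumes "finite_simple_graph G"
  shows "fin_graph (verts G) (adj G)"
proof
  show "x \<in> verts G" if "adj G x y" for x y
    using assms that unfolding finite_simple_graph_def simple_graph_def adj_def by blast
  show "\<not> adj G x x" for x
    using assms unfolding finite_simple_graph_def simple_graph_def adj_def by force
qed (use assms in \<open>auto simp: finite_simple_graph_def adj_def insert_commute\<close>)

lemma edge_cases:
  assumes "finite_simple_graph G" "e \<in> edges G"
  obtains x y where "e = {x, y}" "adj G x y"
  using assms unfolding finite_simple_graph_def simple_graph_def adj_def by (metis card_2_iff)

lemma isomorphic_path_graph:
  assumes G: "finite_simple_graph G" and ps: "fin_graph.induced_path (verts G) (adj G) ps"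
  shows "isomorphic (Graph (set ps) {e \<in> edges G. e \<subseteq> set ps}) (path_graph (length ps))"
proof -
  interpret fin_graph "verts G" "adj G" using G by (rule fin_graph_adj)
  define f where "f = inv_into {..<length ps} ((!) ps)"
  have dist: "distinct ps" using ps by (simp add: induced_path_def)
  have f: "f (ps ! i) = i" if "i < length ps" for i
    unfolding f_def using that dist by (intro inv_into_f_f inj_on_nth) auto
  have "bij_betw f (set ps) {..<length ps}"
    unfolding f_def by (rule bij_betw_inv_into[OF bij_betw_nth]) (use dist in auto)
  moreover have "{{i, Suc i} |i. Suc i < length ps} = (`) f ` {e \<in> edges G. e \<subseteq> set ps}"
  proof (intro equalityI subsetI)
    fix e assume "e \<in> {{i, Suc i} |i. Suc i < length ps}"
    then obtain i where i: "Suc i < length ps" "e = {i, Suc i}" by auto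
    then have "adj G (ps ! i) (ps ! Suc i)" using ps by (simp add: induced_path_def)
    then show "e \<in> (`) f ` {e \<in> edges G. e \<subseteq> set ps}"
      using i f by (intro image_eqI[of _ _ "{ps ! i, ps ! Suc i}"]) (auto simp: adj_def)
  next
    fix e assume "e \<in> (`) f ` {e \<in> edges G. e \<subseteq> set ps}"
    then obtain e' where e': "e = f ` e'" "e' \<in> edges G" "e' \<subseteq> set ps" by auto
    then obtain x y where xy: "e' = {x, y}" "adj G x y" using edge_cases[OF G] by metis
    then obtain i j where ij: "i < length ps" "j < length ps" "x = ps ! i" "y = ps ! j"
      using e'(3) by (metis in_set_conv_nth insert_subset)
    then have "j = Suc i \<or> i = Suc j" using ps xy by (simp add: induced_path_def)
    then show "e \<in> {{i, Suc i} |i. Suc i < length ps}"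
      using e' xy ij f by auto
  qed
  ultimately show ?thesis unfolding isomorphic_def path_graph_def by auto
qed

text \<open>A path subgraph arises only from a list of its vertices in path order and from the
  reversed list.\<close>

lemma card_rainbow_path_lists_le:
  assumes G: "finite_simple_graph G"
  shows "card {ps. fin_graph.induced_path (verts G) (adj G) ps \<and> length ps = s \<and> distinct (map c ps)}
    \<le> 2 * card (induced_rainbow_paths G c s)"
proof -
  interpret fin_graph "verts G" "adj G" using G by (rule fin_graph_adj)
  define R where "R = {ps. induced_path ps \<and> length ps = s \<and> distinct (map c ps)}"
  define gr where "gr ps = Graph (set ps) {e \<in> edges G. e \<subseteq> set ps}" for ps
  \<comment> \<open>Finiteness matters since an infinite set has \<open>card\<close> 0; an induced
    subgraph is determined by its vertex set.\<close>
  have "finite ((\<lambda>A. Graph A {e \<in> edges G. e \<subseteq> A}) ` Pow (verts G))" using finite_V by simp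
  moreover have "induced_rainbow_paths G c s \<subseteq> (\<lambda>A. Graph A {e \<in> edges G. e \<subseteq> A}) ` Pow (verts G)"
  proof
    fix P assume "P \<in> induced_rainbow_paths G c s"
    then have "verts P \<subseteq> verts G" "P = Graph (verts P) {e \<in> edges G. e \<subseteq> verts P}"
      unfolding induced_rainbow_paths_def induced_subgraph_def by (auto intro: graph.expand)
    then show "P \<in> (\<lambda>A. Graph A {e \<in> edges G. e \<subseteq> A}) ` Pow (verts G)" by blast
  qed
  ultimately have fin: "finite (induced_rainbow_paths G c s)" by (rule finite_subset[rotated])
  have gr: "gr ps \<in> induced_rainbow_paths G c s" if "ps \<in> R" for ps
  proof -
    have "isomorphic (gr ps) (path_graph s)"
      using isomorphic_path_graph[OF G, of ps] that unfolding R_def gr_def by auto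
    then show ?thesis
      using that unfolding R_def induced_rainbow_paths_def
      by (auto simp: gr_def induced_subgraph_def rainbow_def induced_path_def distinct_map)
  qed
  have fibre: "card {ps \<in> R. gr ps = P} \<le> 2" for P
  proof (cases "{ps \<in> R. gr ps = P} = {}")
    case False
    then obtain qs where qs: "qs \<in> R" "gr qs = P" by blast
    have "{ps \<in> R. gr ps = P} \<subseteq> {qs, rev qs}"
      using qs induced_path_eq_or_rev[of _ qs] unfolding R_def gr_def by auto
    then have "card {ps \<in> R. gr ps = P} \<le> card {qs, rev qs}" by (intro card_mono) auto
    also have "\<dots> \<le> 2" by (simp add: card_insert_if)
    finally show ?thesis .
  next
    case True
    then show ?thesis by (simp only: card.empty)
  qed
  have "R \<subseteq> {ps. set ps \<subseteq> verts G \<and> length ps = s}" unfolding R_def induced_path_def by auto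
  then have finR: "finite R" using finite_lists_length_eq[OF finite_V] finite_subset by blast
  have "R \<subseteq> (\<Union>P\<in>induced_rainbow_paths G c s. {ps \<in> R. gr ps = P})" using gr by blast
  then have "card R \<le> card (\<Union>P\<in>induced_rainbow_paths G c s. {ps \<in> R. gr ps = P})"
    by (intro card_mono) (use fin finR in auto)
  also have "\<dots> \<le> (\<Sum>P\<in>induced_rainbow_paths G c s. card {ps \<in> R. gr ps = P})"
    using fin by (rule card_UN_le)
  also have "\<dots> \<le> (\<Sum>P\<in>induced_rainbow_paths G c s. 2)" by (intro sum_mono fibre)
  finally show ?thesis unfolding R_def by simp
qed

lemma chromatic_number_attained:
  fixes \<phi> :: "'a \<Rightarrow> nat"
  assumes "proper_coloring G \<phi>" "chromatic_number G \<ge> 1"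
  shows "\<exists>v\<in>verts G. chromatic_number G - 1 \<le> \<phi> v"
proof (rule ccontr)
  assume "\<not> ?thesis"
  then have "\<phi> ` verts G \<subseteq> {..<chromatic_number G - 1}" by auto
  then have "chromatic_number G \<le> chromatic_number G - 1"
    unfolding chromatic_number_def[of G] using assms(1)
    by (intro Least_le) (auto simp: chromatic_number_def)
  then show False using assms(2) by simp
qed

text \<open>Common frame of both cases: the descent starts at a vertex of greedy color at least
  \<open>chromatic_number G - 1\<close>, and only the cost bound remains to be supplied.\<close>

lemma many_induced_rainbow_paths:
  fixes G :: "'a graph" and c :: "'a \<Rightarrow> 'c"
  assumes G: "finite_simple_graph G" and c: "proper_coloring G c" and s: "s \<ge> 1"
    and \<chi>: "chromatic_number G \<ge> 1"
    and cost: "\<And>ps. fin_graph.induced_path (verts G) (adj G) ps \<Longrightarrow> length ps < s \<Longrightarrow>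
      fin_graph.cost (verts G) (adj G) ps \<le> chromatic_number G - 1"
  shows "real (card (induced_rainbow_paths G c s)) \<ge> fact s / 2"
proof -
  interpret fin_graph "verts G" "adj G" using G by (rule fin_graph_adj)
  have "fact s \<le> card {ps. induced_path ps \<and> length ps = s \<and> distinct (map c ps)}"
  proof (rule fact_le_card_rainbow_paths)
    show "c x \<noteq> c y" if "adj G x y" for x y
      using that c unfolding proper_coloring_def adj_def by blast
    fix h :: "'a \<Rightarrow> nat" assume h: "\<And>x y. adj G x y \<Longrightarrow> h x \<noteq> h y"
    obtain \<phi> :: "'a \<Rightarrow> nat" where \<phi>: "\<And>v k. k < \<phi> v \<Longrightarrow> \<exists>u. adj G u v \<and> h u < h v \<and> \<phi> u = k"
      and proper: "\<And>u v. adj G u v \<Longrightarrow> h u < h v \<Longrightarrow> \<phi> u \<noteq> \<phi> v"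
      using first_fit_coloring[of h] by blast
    have "proper_coloring G \<phi>"
      using proper h E_sym unfolding proper_coloring_def adj_def[symmetric] by (metis linorder_neqE_nat)
    then obtain v where v: "v \<in> verts G" "chromatic_number G - 1 \<le> \<phi> v"
      using chromatic_number_attained \<chi> by blast
    show "\<exists>ps. induced_path ps \<and> length ps = s \<and> sorted_wrt (\<lambda>x y. h x < h y) ps"
      using monotone_induced_path[OF \<phi> v cost s order.refl] by blast
  qed
  also have "\<dots> \<le> 2 * card (induced_rainbow_paths G c s)" by (rule card_rainbow_path_lists_le[OF G])
  finally have "real (fact s) \<le> real (2 * card (induced_rainbow_paths G c s))"
    by (simp only: of_nat_le_iff)
  then show ?thesis by simp
qed

lemma codegree_le:
  assumes G: "finite_simple_graph G" and free: "free_of (complete_bipartite 2 r) G" and "r \<ge> 1"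
    and "x \<noteq> y"
  shows "card {z. adj G z x \<and> adj G z y} \<le> r - 1"
proof (rule ccontr)
  interpret fin_graph "verts G" "adj G" using G by (rule fin_graph_adj)
  assume "\<not> ?thesis"
  then have "r \<le> card {z. adj G z x \<and> adj G z y}" by simp
  then obtain T where T: "T \<subseteq> {z. adj G z x \<and> adj G z y}" "card T = r" "finite T"
    by (meson obtain_subset_with_card_n)
  obtain g where g: "bij_betw g T {..<r}"
    using ex_bij_betw_finite_nat[OF T(3)] T(2) by (auto simp: atLeast0LessThan)
  have xyT: "x \<notin> T" "y \<notin> T" using T(1) E_irrefl by blast+
  define f :: "'a \<Rightarrow> nat + nat"
    where "f z = (if z = x then Inl 0 else if z = y then Inl 1 else Inr (g z))" for z
  define K where "K = Graph ({x, y} \<union> T) ((\<lambda>z. {x, z}) ` T \<union> (\<lambda>z. {y, z}) ` T)"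
  have f: "f x = Inl 0" "f y = Inl 1" "\<And>z. z \<in> T \<Longrightarrow> f z = Inr (g z)"
    using xyT \<open>x \<noteq> y\<close> by (auto simp: f_def)
  \<comment> \<open>A common neighbor witnesses that \<open>x\<close> and \<open>y\<close> are
    vertices of \<open>G\<close>.\<close>
  have "T \<noteq> {}" using T(2) \<open>r \<ge> 1\<close> by auto
  then have xy: "x \<in> verts G" "y \<in> verts G" using T(1) E_V E_sym by blast+
  have "edges K \<subseteq> edges G"
    using T(1) by (auto simp: K_def adj_def insert_commute)
  moreover have "verts K \<subseteq> verts G" using xy T(1) E_V by (auto simp: K_def)
  moreover have "card e = 2" if "e \<in> edges K" for e
    using that xyT by (auto simp: K_def card_insert_if)
  moreover have "e \<subseteq> verts K" if "e \<in> edges K" for e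
    using that by (auto simp: K_def)
  ultimately have "subgraph K G" unfolding subgraph_def simple_graph_def by blast
  moreover have "isomorphic K (complete_bipartite 2 r)"
  proof -
    have two: "{..<2 :: nat} = {0, 1}" by auto
    have gT: "g ` T = {..<r}" "inj_on g T" using g by (auto simp: bij_betw_def)
    have "inj_on f ({x, y} \<union> T)"
      using gT(2) by (auto simp: inj_on_def f_def)
    moreover have fT: "f ` T = Inr ` {..<r}"
      unfolding gT(1)[symmetric] image_image by (rule image_cong) (simp_all add: f)
    then have "f ` ({x, y} \<union> T) = Inl ` {..<2} \<union> Inr ` {..<r}"
      by (simp add: two f image_Un)
    ultimately have "bij_betw f (verts K) (Inl ` {..<2} \<union> Inr ` {..<r})"
      by (simp add: K_def bij_betw_def)
    moreover have "(`) f ` edges K = {{Inl i, Inr j} |i j. i < 2 \<and> j < r}"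
    proof -
      have "(`) f ` edges K = (\<lambda>j. {Inl 0, Inr j}) ` g ` T \<union> (\<lambda>j. {Inl 1, Inr j}) ` g ` T"
        unfolding K_def graph.sel image_Un image_image
        by (intro arg_cong2[of _ _ _ _ "(\<union>)"] image_cong) (simp_all add: f)
      also have "\<dots> = {{Inl i, Inr j} |i j. i < 2 \<and> j < r}"
        unfolding gT(1) by (auto simp: less_2_cases_iff)
      finally show ?thesis .
    qed
    ultimately show ?thesis
      unfolding isomorphic_def complete_bipartite_def graph.sel by (intro exI[of _ f] conjI) (simp_all only:)
  qed
  ultimately show False using free unfolding free_of_def by blast
qed

text \<open>A closed sequence of distinct vertices, with its consecutive and closing edges, is a
  copy of \<open>cycle_graph\<close> inside \<open>G\<close>.\<close>

lemma girth_no_short_cycle: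
  assumes G: "finite_simple_graph G" and L: "enat L < girth G"
  shows "fin_graph.no_short_cycle (adj G) L"
proof -
  interpret fin_graph "verts G" "adj G" using G by (rule fin_graph_adj)
  have False if zs: "distinct zs" "3 \<le> length zs" "length zs \<le> L" "successively (adj G) zs"
    "adj G (last zs) (hd zs)" for zs
  proof -
    let ?n = "length zs"
    let ?E = "{{zs ! i, zs ! (Suc i mod ?n)} | i. i < ?n}"
    have ne: "zs \<noteq> []" using zs by auto
    have edge: "adj G (zs ! i) (zs ! (Suc i mod ?n))" if i: "i < ?n" for i
    proof (cases "Suc i = ?n")
      case True
      then have "zs ! i = last zs" using ne by (simp add: last_conv_nth True[symmetric])
      then show ?thesis using zs(5) True ne by (simp add: hd_conv_nth)
    next
      case False
      then show ?thesis using i zs(4) by (simp add: successively_conv_nth)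
    qed
    have E: "?E \<subseteq> edges G" using edge unfolding adj_def by blast
    have "e \<subseteq> set zs" if "e \<in> ?E" for e
      using that ne by (auto intro!: nth_mem)
    moreover have "set zs \<subseteq> verts G"
    proof
      fix z assume "z \<in> set zs"
      then obtain i where "i < ?n" "z = zs ! i" by (auto simp: in_set_conv_nth)
      then show "z \<in> verts G" using edge E_V by blast
    qed
    moreover have "card e = 2" if "e \<in> ?E" for e
      using subsetD[OF E that] G unfolding finite_simple_graph_def simple_graph_def by blast
    ultimately have sub: "subgraph (Graph (set zs) ?E) G"
      using E unfolding subgraph_def simple_graph_def graph.sel by blast
    define f where "f = inv_into {..<?n} ((!) zs)"
    have f: "f (zs ! i) = i" if "i < ?n" for i
      unfolding f_def using that zs(1) by (intro inv_into_f_f inj_on_nth) auto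
    have "bij_betw f (set zs) {..<?n}"
      unfolding f_def by (rule bij_betw_inv_into[OF bij_betw_nth]) (use zs in auto)
    moreover have "{{i, Suc i mod ?n} |i. i < ?n} = (`) f ` ?E"
    proof -
      have "f ` {zs ! i, zs ! (Suc i mod ?n)} = {i, Suc i mod ?n}" if "i < ?n" for i
        using f[of i] f[of "Suc i mod ?n"] that ne by simp
      then have "(\<lambda>i. f ` {zs ! i, zs ! (Suc i mod ?n)}) ` {i. i < ?n} = (\<lambda>i. {i, Suc i mod ?n}) ` {i. i < ?n}"
        by (intro image_cong) auto
      then show ?thesis unfolding setcompr_eq_image image_image by simp
    qed
    ultimately have "isomorphic (Graph (set zs) ?E) (cycle_graph ?n)"
      unfolding isomorphic_def cycle_graph_def by auto
    then have "girth G \<le> enat ?n"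
      unfolding girth_def using sub zs(2) by (intro Inf_lower) blast
    also have "\<dots> \<le> enat L" using zs(3) by simp
    finally show False using L by simp
  qed
  then show ?thesis unfolding no_short_cycle_def by blast
qed

section \<open>The two cases of the theorem\<close>

lemma induced_rainbow_paths_K2r_free:
  fixes G :: "'a graph" and c :: "'a \<Rightarrow> 'c"
  assumes s: "s \<ge> 1" and G: "finite_simple_graph G" and c: "proper_coloring G c"
    and r: "r \<ge> 2" and free: "free_of (complete_bipartite 2 r) G"
    and \<chi>: "real (chromatic_number G) \<ge> (real r - 1) * (real s - 1) * real s / 2 + real s"
  shows "real (card (induced_rainbow_paths G c s)) \<ge> fact s / 2"
proof -
  interpret fin_graph "verts G" "adj G" using G by (rule fin_graph_adj)
  have "(real r - 1) * (real s - 1) * real s \<ge> 0" using r s by simp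
  then have \<chi>1: "chromatic_number G \<ge> 1" using \<chi> s by linarith
  show ?thesis
  proof (rule many_induced_rainbow_paths[OF G c s \<chi>1])
    fix ps assume ps: "induced_path ps" "length ps < s"
    define d where "d = r - 1"
    define l where "l = length ps"
    have "2 * cost ps + d * l \<le> 2 * l + d * l\<^sup>2"
      using cost_bound_codegree[OF codegree_le[OF G free] ps(1)] r unfolding d_def l_def by simp
    then have "2 * real (cost ps) + real d * real l \<le> 2 * real l + real d * (real l)\<^sup>2"
      by (metis (mono_tags) of_nat_add of_nat_le_iff of_nat_mult of_nat_numeral of_nat_power)
    then have "2 * real (cost ps) \<le> 2 * real l + real d * (real l * (real l - 1))"
      by (simp add: algebra_simps power2_eq_square)
    moreover have "real d * (real l * (real l - 1)) \<le> real d * (real s * (real s - 1))"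
    proof (rule mult_left_mono)
      show "real l * (real l - 1) \<le> real s * (real s - 1)"
      \<comment> \<open>For \<open>l = 0\<close> the factor \<open>real l - 1\<close> is negative,
        so monotonicity of products does not apply.\<close>
      proof (cases "l = 0")
        case False
        then have "1 \<le> l" by simp
        then show ?thesis using ps(2) s unfolding l_def by (intro mult_mono) linarith+
      qed (use s in simp)
    qed simp
    moreover have "real l \<le> real s - 1" using ps(2) unfolding l_def by linarith
    moreover have "real (chromatic_number G) \<ge> real d * (real s * (real s - 1)) / 2 + real s"
      using \<chi> r unfolding d_def by (simp add: of_nat_diff mult_ac)
    ultimately have "real (cost ps) \<le> real (chromatic_number G) - 1" by linarith
    then show "cost ps \<le> chromatic_number G - 1" by linarith
  qed
qed

lemma induced_rainbow_paths_girth: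
  fixes G :: "'a graph" and c :: "'a \<Rightarrow> 'c"
  assumes s: "s \<ge> 1" and G: "finite_simple_graph G" and c: "proper_coloring G c"
    and girth: "girth G \<ge> 5"
    and \<chi>: "real (chromatic_number G) \<ge>
      real s powr (1 + real_of_ereal (4 / (ereal_of_enat (girth G) - 4)))"
  shows "real (card (induced_rainbow_paths G c s)) \<ge> fact s / 2"
proof -
  interpret fin_graph "verts G" "adj G" using G by (rule fin_graph_adj)
  define \<epsilon> where "\<epsilon> = real_of_ereal (4 / (ereal_of_enat (girth G) - 4))"
  have "\<exists>k b. k > 0 \<and> b \<ge> 1 \<and> enat (4 * k) < girth G \<and> real s \<le> b ^ k \<and>
    b * (real s - 1) < real (chromatic_number G)"
  proof (cases "girth G")
    case (enat g)
    have g: "g \<ge> 5" using girth enat by (simp add: numeral_eq_enat)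
    \<comment> \<open>The largest \<open>k\<close> with \<open>4 * k < g\<close>; then
      \<open>g - 4 \<le> 4 * k\<close>, which yields \<open>1 / k \<le> \<epsilon>\<close>.\<close>
    define k where "k = (g - 1) div 4"
    have k: "k > 0" "4 * k < g" "g \<le> 4 * k + 4" using g unfolding k_def by linarith+
    define b where "b = real s powr (1 / real k)"
    have \<epsilon>: "\<epsilon> = 4 / (real g - 4)" unfolding \<epsilon>_def enat using girth_exponent_finite[OF g] .
    have "1 / real k \<le> \<epsilon>"
      unfolding \<epsilon> using k g by (simp add: field_simps)
    then have b: "1 \<le> b" "b \<le> real s powr \<epsilon>"
      unfolding b_def using s by (auto intro: ge_one_powr_ge_zero powr_mono)
    have "b ^ k = real s"
      unfolding b_def using s k by (simp add: powr_powr flip: powr_realpow)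
    moreover have "b * (real s - 1) < real (chromatic_number G)"
    proof -
      have "b * (real s - 1) < b * real s" using b by simp
      also have "\<dots> \<le> real s powr \<epsilon> * real s" using b by (intro mult_right_mono) auto
      also have "\<dots> = real s powr (1 + \<epsilon>)" using s by (simp add: powr_add)
      finally show ?thesis using \<chi> unfolding \<epsilon>_def by linarith
    qed
    ultimately show ?thesis using k b enat by (intro exI[of _ k] exI[of _ b]) auto
  next
    case infinity
    \<comment> \<open>Without cycles every \<open>k\<close> is allowed, so \<open>b\<close> may be
      fixed first and \<open>k\<close> taken large. This \<open>b\<close> satisfies
      \<open>b * (s - 1) = s - 1 / s < s\<close>.\<close>
    define b where "b = 1 + 1 / real s"
    have b: "b > 1" using s unfolding b_def by simp
    obtain k where k: "real s < b ^ k" using real_arch_pow[OF b] by blast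
    moreover have "k > 0" using k s by (cases k) auto
    moreover have "real s \<le> real (chromatic_number G)"
      using \<chi> s girth_exponent_infinite unfolding infinity by simp
    moreover have "b * (real s - 1) < real s" using s unfolding b_def by (simp add: field_simps)
    ultimately show ?thesis using b infinity by (intro exI[of _ k] exI[of _ b]) auto
  qed
  then obtain k b where kb: "k > 0" "b \<ge> 1" "enat (4 * k) < girth G" "real s \<le> b ^ k"
    "b * (real s - 1) < real (chromatic_number G)" by blast
  have "0 \<le> b * (real s - 1)" using kb(2) s by simp
  then have \<chi>1: "chromatic_number G \<ge> 1" using kb(5) by linarith
  show ?thesis
  proof (rule many_induced_rainbow_paths[OF G c s \<chi>1])
    fix ps assume ps: "induced_path ps" "length ps < s"
    have "real (cost ps) \<le> b * real (length ps)"
      by (rule cost_bound_girth[OF girth_no_short_cycle[OF G kb(3)] kb(1,2) ps(1)]) (use ps kb in linarith)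
    also have "\<dots> \<le> b * (real s - 1)" using ps(2) kb(2) by (intro mult_left_mono) linarith+
    finally have "real (cost ps) < real (chromatic_number G)" using kb(5) by linarith
    then show "cost ps \<le> chromatic_number G - 1" by linarith
  qed
qed

theorem theorem6:
  fixes G :: "'a graph" and c :: "'a \<Rightarrow> 'c" and s :: nat
  assumes "s \<ge> 1"
    and "finite_simple_graph G"
    and "proper_coloring G c"
  shows "(\<forall>r::nat. r \<ge> 2 \<and> free_of (complete_bipartite 2 r) G \<and>
            real (chromatic_number G) \<ge> (real r - 1) * (real s - 1) * real s / 2 + real s
            \<longrightarrow> real (card (induced_rainbow_paths G c s)) \<ge> fact s / 2)
       \<and> (girth G \<ge> 5 \<and>
            real (chromatic_number G) \<ge>
              real s powr (1 + real_of_ereal (4 / (ereal_of_enat (girth G) - 4)))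
            \<longrightarrow> real (card (induced_rainbow_paths G c s)) \<ge> fact s / 2)"
  using induced_rainbow_paths_K2r_free[OF assms] induced_rainbow_paths_girth[OF assms] by blast

end
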